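(* Let $q$ be a prime power and let $r,n,m$ be integers with $2\le 2r\le n\le m$. Then any $S\in E_{2r}(q^m,n)$ has diameter $2r$ (with respect to the rank distance) and cardinality $|S|>V_r(q^m,n)$.
   Context: For $\mathbf{x}\in \mathrm{GF}(q^m)^n$, $\mathrm{rk}(\mathbf{x})$ is the maximum number of coordinates of $\mathbf{x}$ that are linearly independent over $\mathrm{GF}(q)$; the rank distance is $d_R(\mathbf{x},\mathbf{y})=\mathrm{rk}(\mathbf{x}-\mathbf{y})$. The diameter of a set is the maximum distance between any pair of its elements. $V_r(q^m,n)$ is the number of vectors in a ball of rank radius $r$ in $\mathrm{GF}(q^m)^n$. A $\mathrm{GF}(q^m)$-linear subspace of $\mathrm{GF}(q^m)^n$ is an elementary linear subspace (ELS) if it has a basis consisting of vectors in $\mathrm{GF}(q)^n$; $E_v(q^m,n)$ denotes the set of all ELS's of dimension $v$. *)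

theory Defs
  imports "HOL-Analysis.Analysis" "HOL-Number_Theory.Prime_Powers"
begin

text \<open>
  GF(q^m) is a type \<open>'a\<close> of class field and finite with \<open>CARD('a) = q ^ m\<close>; GF(q) is a subfield
  \<open>K\<close> of it with \<open>card K = q\<close>; GF(q^m)^n is \<open>'a ^ 'n\<close> with \<open>CARD('n) = n\<close>.
\<close>

definition is_subfield :: "'a::field set \<Rightarrow> bool" where
  "is_subfield K \<longleftrightarrow>
     0 \<in> K \<and> 1 \<in> K \<and>
     (\<forall>x\<in>K. \<forall>y\<in>K. x + y \<in> K \<and> x * y \<in> K) \<and>
     (\<forall>x\<in>K. - x \<in> K \<and> inverse x \<in> K)"

text \<open>
  Linear independence over \<open>K\<close> of the coordinates of \<open>x\<close> at the positions in \<open>J\<close>, as an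
  indexed family: equal coordinates at two different positions are dependent.
\<close>

definition coords_indep :: "'a::field set \<Rightarrow> 'a ^ 'n \<Rightarrow> 'n::finite set \<Rightarrow> bool" where
  "coords_indep K x J \<longleftrightarrow>
     (\<forall>c. (\<forall>j\<in>J. c j \<in> K) \<and> (\<Sum>j\<in>J. c j * x $ j) = 0 \<longrightarrow> (\<forall>j\<in>J. c j = 0))"

definition rk :: "'a::field set \<Rightarrow> 'a ^ 'n::finite \<Rightarrow> nat" where
  "rk K x = Max {card J |J. coords_indep K x J}"

definition rank_dist :: "'a::field set \<Rightarrow> 'a ^ 'n::finite \<Rightarrow> 'a ^ 'n \<Rightarrow> nat" where
  "rank_dist K x y = rk K (x - y)"

text \<open>\<open>Max\<close> is the true maximum only for nonempty finite \<open>S\<close>.\<close>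

definition rank_diameter :: "'a::field set \<Rightarrow> ('a ^ 'n::finite) set \<Rightarrow> nat" where
  "rank_diameter K S = Max {rank_dist K x y |x y. x \<in> S \<and> y \<in> S}"

definition rank_ball :: "'a::field set \<Rightarrow> 'a ^ 'n::finite \<Rightarrow> nat \<Rightarrow> ('a ^ 'n) set" where
  "rank_ball K c r = {x. rank_dist K c x \<le> r}"

text \<open>The ball is centred at 0; by \<open>card_rank_ball\<close> below, the centre is irrelevant.\<close>

definition rank_ball_volume :: "'a::field set \<Rightarrow> 'n::finite itself \<Rightarrow> nat \<Rightarrow> nat" where
  "rank_ball_volume K _ r = card (rank_ball K (0 :: 'a ^ 'n) r)"

lemma card_rank_ball:
  fixes c :: "'a::field ^ 'n::finite"
  shows "card (rank_ball K c r) = rank_ball_volume K TYPE('n) r"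
proof -
  have "bij_betw (\<lambda>x. x + c) (rank_ball K 0 r) (rank_ball K c r)"
    by (rule bij_betwI[where g = "\<lambda>x. x - c"])
       (auto simp: rank_ball_def rank_dist_def algebra_simps)
  then show ?thesis
    unfolding rank_ball_volume_def using bij_betw_same_card by metis
qed

definition elementary_linear_subspaces ::
    "'a::field set \<Rightarrow> nat \<Rightarrow> ('a ^ 'n::finite) set set" where
  "elementary_linear_subspaces K v =
     {S. vec.subspace S \<and> vec.dim S = v \<and>
         (\<exists>B. B \<subseteq> {x. \<forall>i. x $ i \<in> K} \<and> vec.independent B \<and> vec.span B = S)}"

end

theory Submission
  imports Defs
begin

text \<open>
  Everything is a count. A vector of rank at most \<open>r\<close> has all its coordinates in the
  \<open>K\<close>-span of \<open>r\<close> of them, so it is a product \<open>A b\<close> with \<open>b \<in> GF(q\<^sup>m)\<^sup>r\<close> and \<open>A\<close> an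
  \<open>n \<times> r\<close> matrix over \<open>K\<close>. There are \<open>q\<^sup>m\<^sup>r q\<^sup>n\<^sup>r \<le> q\<^sup>2\<^sup>r\<^sup>m\<close> pairs \<open>(A, b)\<close>, and \<open>b = 0\<close>
  shows that the parametrization is not injective, which makes the inequality strict.

  For the diameter, a vector of \<open>S\<close> has its coordinates in the \<open>K\<close>-span of its \<open>2r\<close> coefficients
  with respect to a basis in \<open>K\<^sup>n\<close>, so its rank is at most \<open>2r\<close>. Conversely, if \<open>J\<close> is
  minimal among the sets of positions on which only the zero vector of \<open>S\<close> vanishes, then
  restriction to \<open>J\<close> maps \<open>S\<close> onto all families indexed by \<open>J\<close>, and \<open>card J \<ge> 2r\<close>. Hence some vector
  of \<open>S\<close> has \<open>2r\<close> coordinates that are linearly independent over \<open>K\<close>.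
\<close>

section \<open>Spans and linear independence over the subfield \<open>K\<close>\<close>

definition kspan :: "'a::field set \<Rightarrow> ('i \<Rightarrow> 'a) \<Rightarrow> 'i set \<Rightarrow> 'a set" where
  "kspan K f I = {\<Sum>i\<in>I. c i * f i |c. \<forall>i\<in>I. c i \<in> K}"

lemma is_subfieldD:
  assumes "is_subfield K"
  shows "0 \<in> K" "1 \<in> K" "x \<in> K \<Longrightarrow> y \<in> K \<Longrightarrow> x + y \<in> K" "x \<in> K \<Longrightarrow> y \<in> K \<Longrightarrow> x * y \<in> K"
    "x \<in> K \<Longrightarrow> - x \<in> K" "x \<in> K \<Longrightarrow> inverse x \<in> K"
  using assms by (auto simp: is_subfield_def)

lemma is_subfield_sum:
  assumes "is_subfield K" "\<And>i. i \<in> I \<Longrightarrow> f i \<in> K"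
  shows "sum f I \<in> K"
  using assms(2) by (induction I rule: infinite_finite_induct) (auto simp: is_subfieldD[OF assms(1)])

lemma kspanI: "(\<And>i. i \<in> I \<Longrightarrow> c i \<in> K) \<Longrightarrow> (\<Sum>i\<in>I. c i * f i) \<in> kspan K f I"
  unfolding kspan_def by blast

text \<open>Extensional coefficient families form a finite set of known size, so the span can be
  counted: the image is never larger, and it is equally large when the map is injective.\<close>

lemma kspan_eq_image: "kspan K f I = (\<lambda>c. \<Sum>i\<in>I. c i * f i) ` (I \<rightarrow>\<^sub>E K)"
proof (intro equalityI subsetI)
  fix y assume "y \<in> kspan K f I"
  then obtain c where c: "\<forall>i\<in>I. c i \<in> K" "y = (\<Sum>i\<in>I. c i * f i)"
    unfolding kspan_def by blast
  then have "y = (\<Sum>i\<in>I. restrict c I i * f i)" by simp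
  with c(1) show "y \<in> (\<lambda>c. \<Sum>i\<in>I. c i * f i) ` (I \<rightarrow>\<^sub>E K)"
    by (intro image_eqI[where x = "restrict c I"]) auto
qed (auto intro!: kspanI)

lemma card_kspan_le:
  assumes "finite I" "finite K"
  shows "card (kspan K f I) \<le> card K ^ card I"
  using card_image_le[of "I \<rightarrow>\<^sub>E K" "\<lambda>c. \<Sum>i\<in>I. c i * f i"] assms
  by (simp add: kspan_eq_image card_PiE finite_PiE)

lemma kspan_mono:
  assumes "is_subfield K" "finite J" "I \<subseteq> J"
  shows "kspan K f I \<subseteq> kspan K f J"
proof
  fix y assume "y \<in> kspan K f I"
  then obtain c where c: "\<forall>i\<in>I. c i \<in> K" "y = (\<Sum>i\<in>I. c i * f i)"
    unfolding kspan_def by blast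
  have "y = (\<Sum>i\<in>J. (if i \<in> I then c i else 0) * f i)"
    unfolding c(2) using assms by (intro sum.mono_neutral_cong_left) auto
  moreover have "\<dots> \<in> kspan K f J"
    using c(1) is_subfieldD(1)[OF assms(1)] by (intro kspanI) auto
  ultimately show "y \<in> kspan K f J" by simp
qed

lemma kspan_base:
  assumes "is_subfield K" "finite I" "i \<in> I"
  shows "f i \<in> kspan K f I"
proof -
  have "f i = (\<Sum>j\<in>I. (if j = i then 1 else 0) * f j)"
    using assms by (simp add: if_distrib[of "\<lambda>x. x * _"] cong: if_cong)
  also have "\<dots> \<in> kspan K f I"
    using is_subfieldD(1,2)[OF assms(1)] by (intro kspanI) auto
  finally show ?thesis .
qed

lemma card_kspan_coords_indep:
  fixes x :: "'a::field ^ 'n::finite"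
  assumes "is_subfield K" "coords_indep K x J"
  shows "card (kspan K (\<lambda>j. x $ j) J) = card K ^ card J"
proof -
  have "inj_on (\<lambda>c. \<Sum>j\<in>J. c j * x $ j) (J \<rightarrow>\<^sub>E K)"
  proof (rule inj_onI)
    fix c d assume cd: "c \<in> J \<rightarrow>\<^sub>E K" "d \<in> J \<rightarrow>\<^sub>E K"
      and eq: "(\<Sum>j\<in>J. c j * x $ j) = (\<Sum>j\<in>J. d j * x $ j)"
    have "\<forall>j\<in>J. c j + - d j \<in> K"
      using PiE_mem[OF cd(1)] PiE_mem[OF cd(2)]
      by (intro ballI is_subfieldD(3,5)[OF assms(1)]) blast+
    moreover have "(\<Sum>j\<in>J. (c j + - d j) * x $ j) = 0"
      using eq by (simp add: algebra_simps sum_subtractf)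
    ultimately have "\<forall>j\<in>J. c j + - d j = 0"
      using assms(2)[unfolded coords_indep_def, rule_format, of "\<lambda>j. c j + - d j"] by blast
    then show "c = d" using cd by (intro PiE_ext[of c J _ d]) auto
  qed
  then show ?thesis by (simp add: kspan_eq_image card_image card_PiE)
qed

text \<open>A dependence with nonzero coefficient at \<open>i\<close> could be solved for
  \<open>x $ i\<close>, which would place it in the span.\<close>

lemma coords_indep_insert:
  fixes x :: "'a::field ^ 'n::finite"
  assumes K: "is_subfield K" and J: "coords_indep K x J" "x $ i \<notin> kspan K (\<lambda>j. x $ j) J"
  shows "coords_indep K x (insert i J)"
  unfolding coords_indep_def
proof (intro allI impI)
  fix c assume c: "(\<forall>j\<in>insert i J. c j \<in> K) \<and> (\<Sum>j\<in>insert i J. c j * x $ j) = 0"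
  have i: "i \<notin> J" using kspan_base[OF K, of J i "\<lambda>j. x $ j"] J(2) by auto
  then have eq: "c i * x $ i + (\<Sum>j\<in>J. c j * x $ j) = 0" using c by simp
  have "c i = 0"
  proof (rule ccontr)
    assume ci: "c i \<noteq> 0"
    have "x $ i = - inverse (c i) * (\<Sum>j\<in>J. c j * x $ j)"
      using eq ci by (simp add: field_simps add_eq_0_iff)
    also have "\<dots> = (\<Sum>j\<in>J. (- inverse (c i) * c j) * x $ j)"
      by (simp only: sum_distrib_left mult.assoc)
    also have "\<dots> \<in> kspan K (\<lambda>j. x $ j) J"
      by (rule kspanI, rule is_subfieldD(4)[OF K], rule is_subfieldD(5)[OF K],
          rule is_subfieldD(6)[OF K]) (use c in auto)
    finally show False using J(2) by simp
  qed
  moreover have "\<forall>j\<in>J. c j = 0"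
    using J(1)[unfolded coords_indep_def, rule_format, of c] c eq calculation by auto
  ultimately show "\<forall>j\<in>insert i J. c j = 0" by simp
qed

text \<open>Greedy choice: the coordinates chosen so far span fewer than \<open>CARD('a)\<close>
  elements, so a field element outside their span remains for the next position.\<close>

lemma ex_coords_indep:
  fixes K :: "'a::{field,finite} set" and J :: "'n::finite set"
  assumes K: "is_subfield K" and "card K ^ card J \<le> CARD('a)"
  shows "\<exists>x :: 'a ^ 'n. coords_indep K x J"
  using finite[of J] assms(2)
proof (induction J)
  case empty
  then show ?case by (simp add: coords_indep_def)
next
  case (insert i J)
  have "{0, 1} \<subseteq> K" using is_subfieldD(1,2)[OF K] by simp
  then have "1 < card K" using card_mono[of K "{0, 1}"] by simp
  then have lt: "card K ^ card J < CARD('a)"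
    using insert.prems insert.hyps power_strict_increasing[OF lessI[of "card J"]]
    by (fastforce simp del: power_Suc intro: less_le_trans)
  then obtain x :: "'a ^ 'n" where x: "coords_indep K x J" using insert.IH by auto
  have "card (kspan K (\<lambda>j. x $ j) J) < CARD('a)"
    using card_kspan_le[of J K "\<lambda>j. x $ j"] lt by simp
  then obtain y where y: "y \<notin> kspan K (\<lambda>j. x $ j) J"
    by (metis UNIV_eq_I less_irrefl)
  \<comment> \<open>Only position \<open>i\<close>, outside \<open>J\<close>, is overwritten, so
    sums over \<open>J\<close> do not change.\<close>
  define x' :: "'a ^ 'n" where "x' = (\<chi> j. if j = i then y else x $ j)"
  have sum: "(\<Sum>j\<in>J. c j * x' $ j) = (\<Sum>j\<in>J. c j * x $ j)" for c
    using insert.hyps by (intro sum.cong) (auto simp: x'_def)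
  have "coords_indep K x' J" using x by (simp add: coords_indep_def sum)
  moreover have "x' $ i \<notin> kspan K (\<lambda>j. x' $ j) J" using y by (simp add: kspan_def sum) (simp add: x'_def)
  ultimately show ?case using coords_indep_insert[OF K] by blast
qed

section \<open>Rank and spans of coordinates\<close>

lemma coords_indep_imp_le_rk:
  fixes x :: "'a::field ^ 'n::finite"
  assumes "coords_indep K x J"
  shows "card J \<le> rk K x"
  unfolding rk_def using assms by (intro Max_ge) (auto intro: finite_image_set)

lemma rk_obtain:
  fixes x :: "'a::field ^ 'n::finite"
  obtains J where "coords_indep K x J" "card J = rk K x"
proof -
  have "rk K x \<in> {card J |J. coords_indep K x J}"
    unfolding rk_def
    by (intro Max_in) (auto intro: finite_image_set exI[of _ "{}"] simp: coords_indep_def)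
  then show ?thesis using that by auto
qed

text \<open>An independent set of positions of maximal size works: a coordinate outside its span
  could be added to it.\<close>

lemma rk_obtain_kspan:
  fixes x :: "'a::field ^ 'n::finite"
  assumes K: "is_subfield K"
  obtains J where "card J = rk K x" "\<And>i. x $ i \<in> kspan K (\<lambda>j. x $ j) J"
proof -
  obtain J where J: "coords_indep K x J" "card J = rk K x" by (rule rk_obtain)
  have "x $ i \<in> kspan K (\<lambda>j. x $ j) J" for i
  proof (rule ccontr)
    assume i: "x $ i \<notin> kspan K (\<lambda>j. x $ j) J"
    then have "i \<notin> J" using kspan_base[OF K, of J i "\<lambda>j. x $ j"] by auto
    moreover have "card (insert i J) \<le> rk K x"
      using coords_indep_imp_le_rk[OF coords_indep_insert[OF K J(1) i]] .
    ultimately show False using J(2) by simp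
  qed
  with J(2) that show ?thesis by blast
qed

text \<open>Counting replaces the exchange argument: independent coordinates at \<open>J\<close>
  span exactly \<open>card K ^ card J\<close> elements, all within a set of at most
  \<open>card K ^ card I\<close>.\<close>

lemma rk_le_kspan:
  fixes x :: "'a::field ^ 'n::finite"
  assumes K: "is_subfield K" "finite K" and "finite I" and x: "\<And>j. x $ j \<in> kspan K f I"
  shows "rk K x \<le> card I"
proof -
  obtain J where J: "coords_indep K x J" "card J = rk K x" by (rule rk_obtain)
  obtain a where a: "\<And>j i. i \<in> I \<Longrightarrow> a j i \<in> K" "\<And>j. x $ j = (\<Sum>i\<in>I. a j i * f i)"
    using x unfolding kspan_def by simp metis
  have "kspan K (\<lambda>j. x $ j) J \<subseteq> kspan K f I"
  proof
    fix y assume "y \<in> kspan K (\<lambda>j. x $ j) J"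
    then obtain c where c: "\<forall>j\<in>J. c j \<in> K" "y = (\<Sum>j\<in>J. c j * x $ j)"
      unfolding kspan_def by blast
    have "y = (\<Sum>i\<in>I. (\<Sum>j\<in>J. c j * a j i) * f i)"
      unfolding c(2) a(2) sum_distrib_left sum_distrib_right
      by (subst sum.swap) (simp add: mult.assoc)
    also have "\<dots> \<in> kspan K f I"
      using c(1) a(1) by (intro kspanI is_subfield_sum[OF K(1)] is_subfieldD(4)[OF K(1)]) auto
    finally show "y \<in> kspan K f I" .
  qed
  moreover have "finite (kspan K f I)"
    using assms by (simp add: kspan_eq_image finite_PiE)
  ultimately have "card K ^ card J \<le> card K ^ card I"
    using card_mono card_kspan_coords_indep[OF K(1) J(1)] card_kspan_le[OF \<open>finite I\<close> K(2), of f]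
    by (metis order_trans)
  moreover have "1 < card K"
    using card_mono[OF K(2), of "{0, 1}"] is_subfieldD(1,2)[OF K(1)] by simp
  ultimately show ?thesis using J(2) by simp
qed

section \<open>Counting the rank ball\<close>

lemma card_rank_ball_less:
  fixes K :: "'a::{field,finite} set"
  assumes K: "is_subfield K" and r: "0 < r" "r \<le> CARD('n::finite)"
  shows "rank_ball_volume K TYPE('n) r < CARD('a) ^ r * card K ^ (CARD('n) * r)"
proof -
  define P where "P = (({..<r} \<rightarrow>\<^sub>E (UNIV :: 'a set)) \<times> ((UNIV :: 'n set) \<times> {..<r} \<rightarrow>\<^sub>E K))"
  define F :: "_ \<Rightarrow> 'a ^ 'n" where "F = (\<lambda>(b, A). \<chi> i. \<Sum>t<r. A (i, t) * b t)"
  have finP: "finite P" by (simp add: P_def finite_PiE)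
  have cardP: "card P = CARD('a) ^ r * card K ^ (CARD('n) * r)"
    by (simp add: P_def card_cartesian_product card_PiE)
  have sub: "rank_ball K (0 :: 'a ^ 'n) r \<subseteq> F ` P"
  proof
    fix z :: "'a ^ 'n" assume "z \<in> rank_ball K 0 r"
    then have "rk K (- z) \<le> r" by (simp add: rank_ball_def rank_dist_def)
    moreover define x where "x = - z"
    ultimately have rk: "rk K x \<le> r" by simp
    obtain J where J: "card J = rk K x" "\<And>i. x $ i \<in> kspan K (\<lambda>j. x $ j) J"
      using rk_obtain_kspan[OF K] by metis
    \<comment> \<open>Padding to exactly \<open>r\<close> positions lets one parameter set
      \<open>P\<close> serve all ranks up to \<open>r\<close>.\<close>
    obtain J' where J': "J \<subseteq> J'" "card J' = r"
      using exists_subset_between[of J r UNIV] J(1) rk r(2) by auto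
    obtain h where h: "bij_betw h {..<r} J'"
      using ex_bij_betw_nat_finite[of J'] J'(2) by (auto simp: atLeast0LessThan)
    have "\<exists>c. (\<forall>j\<in>J'. c j \<in> K) \<and> x $ i = (\<Sum>j\<in>J'. c j * x $ j)" for i
      using subsetD[OF kspan_mono[OF K finite J'(1)] J(2)[of i]] unfolding kspan_def by auto
    then obtain c where c: "\<And>i j. j \<in> J' \<Longrightarrow> c i j \<in> K" "\<And>i. x $ i = (\<Sum>j\<in>J'. c i j * x $ j)"
      by metis
    \<comment> \<open>The distance from 0 to \<open>z\<close> is the rank of \<open>- z\<close>,
      which is \<open>x\<close>; the minus sign in \<open>b\<close> turns \<open>x\<close> back into
      \<open>z\<close>.\<close>
    define b where "b = restrict (\<lambda>t. - x $ h t) {..<r}"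
    define A where "A = restrict (\<lambda>(i, t). c i (h t)) (UNIV \<times> {..<r})"
    have "z = F (b, A)"
    proof (rule vec_eq_iff[THEN iffD2], rule allI)
      fix i
      have "z $ i = - x $ i" by (simp add: x_def)
      also have "\<dots> = - (\<Sum>j\<in>J'. c i j * x $ j)" using c(2)[of i] by (rule arg_cong)
      also have "\<dots> = - (\<Sum>t<r. c i (h t) * x $ h t)"
        by (simp add: sum.reindex_bij_betw[OF h, of "\<lambda>j. c i j * x $ j"])
      also have "\<dots> = F (b, A) $ i" by (simp add: F_def A_def b_def sum_negf)
      finally show "z $ i = F (b, A) $ i" .
    qed
    moreover have "(b, A) \<in> P"
      using c(1) bij_betwE[OF h] by (auto simp: P_def b_def A_def)
    ultimately show "z \<in> F ` P" by blast
  qed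
  have "\<not> inj_on F P"
  proof
    assume inj: "inj_on F P"
    \<comment> \<open>For \<open>b = 0\<close> the matrix does not affect the product; the all-zero
      and all-one matrices differ because \<open>r > 0\<close> provides an entry.\<close>
    define b where "b = restrict (\<lambda>_. 0 :: 'a) {..<r}"
    define A where "A k = restrict (\<lambda>_. k :: 'a) ((UNIV :: 'n set) \<times> {..<r})" for k
    have "F (b, A 0) = F (b, A 1)" by (simp add: F_def b_def)
    moreover have "(b, A 0) \<in> P" "(b, A 1) \<in> P"
      using is_subfieldD(1,2)[OF K] by (auto simp: P_def A_def b_def)
    ultimately have "A 0 = A 1" using inj by (auto dest: inj_onD)
    then have "A 0 (undefined, 0) = A 1 (undefined, 0)" by simp
    then show False using r(1) by (simp add: A_def)
  qed
  then have "card (F ` P) < card P"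
    using finP card_image_le eq_card_imp_inj_on by (metis order_le_imp_less_or_eq)
  moreover have "card (rank_ball K (0 :: 'a ^ 'n) r) \<le> card (F ` P)"
    using sub finP by (intro card_mono) auto
  ultimately show ?thesis by (simp add: rank_ball_volume_def cardP)
qed

section \<open>Size of subspaces and their restriction to coordinates\<close>

lemma card_vec_span_independent:
  fixes B :: "('a::{field,finite} ^ 'n::finite) set"
  assumes B: "vec.independent B"
  shows "card (vec.span B) = CARD('a) ^ card B"
proof -
  let ?F = "\<lambda>u. \<Sum>v\<in>B. u v *s v"
  have "vec.span B = ?F ` (B \<rightarrow>\<^sub>E UNIV)"
  proof -
    have "?F u \<in> ?F ` (B \<rightarrow>\<^sub>E UNIV)" for u
      by (rule image_eqI[where x = "restrict u B"]) auto
    then show ?thesis by (auto simp: vec.span_finite)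
  qed
  moreover have "inj_on ?F (B \<rightarrow>\<^sub>E UNIV)"
  proof (rule inj_onI)
    fix u w assume uw: "u \<in> B \<rightarrow>\<^sub>E UNIV" "w \<in> B \<rightarrow>\<^sub>E UNIV" and "?F u = ?F w"
    then have "(\<Sum>v\<in>B. (u v - w v) *s v) = 0"
      by (simp add: vec.scale_left_diff_distrib sum_subtractf)
    then have "\<forall>v\<in>B. u v - w v = 0"
      using vec.independentD[OF B finite subset_refl, of "\<lambda>v. u v - w v"] by blast
    then show "u = w" using uw by (intro PiE_ext[of u B _ w]) auto
  qed
  ultimately show ?thesis by (simp add: card_image card_PiE)
qed

text \<open>For a minimal determining set \<open>J\<close>, restriction to \<open>J\<close> is
  injective on \<open>S\<close>, which gives the bound; minimality makes it surjective.\<close>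

lemma subspace_onto_coords:
  fixes S :: "('a::{field,finite} ^ 'n::finite) set"
  assumes S: "vec.subspace S"
  obtains J where "card S \<le> CARD('a) ^ card J" "\<And>x. \<exists>s\<in>S. \<forall>j\<in>J. s $ j = x $ j"
proof -
  define det where "det J \<longleftrightarrow> (\<forall>s\<in>S. (\<forall>j\<in>J. s $ j = 0) \<longrightarrow> s = 0)" for J
  have "det UNIV" by (simp add: det_def vec_eq_iff)
  then obtain J where J: "det J" and min: "\<And>J'. det J' \<Longrightarrow> card J \<le> card J'"
    using ex_has_least_nat[of det UNIV card] by blast
  let ?\<rho> = "\<lambda>s. restrict (\<lambda>j. s $ j) J"
  have "inj_on ?\<rho> S"
  proof (rule inj_onI)
    fix s t assume st: "s \<in> S" "t \<in> S" "?\<rho> s = ?\<rho> t"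
    have "(s - t) $ j = 0" if "j \<in> J" for j using fun_cong[OF st(3), of j] that by simp
    then have "s - t = 0" using J vec.subspace_diff[OF S st(1,2)] unfolding det_def by blast
    then show "s = t" by simp
  qed
  then have "card S \<le> card (J \<rightarrow>\<^sub>E (UNIV :: 'a set))"
    by (rule card_inj_on_le) (auto simp: finite_PiE)
  then have "card S \<le> CARD('a) ^ card J" by (simp add: card_PiE)
  moreover have "\<exists>s\<in>S. \<forall>j\<in>J. s $ j = x $ j" for x
  proof -
    \<comment> \<open>Without \<open>i\<close> the set no longer determines \<open>S\<close>: some
      nonzero \<open>s\<close> vanishes on the rest of \<open>J\<close>, hence not at
      \<open>i\<close>, and rescaling gives a unit vector on \<open>J\<close>. Combinations of these
      reach any prescribed values.\<close>
    have "\<exists>e\<in>S. \<forall>j\<in>J. e $ j = (if j = i then 1 else 0)" if i: "i \<in> J" for i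
    proof -
      have "\<not> det (J - {i})"
        using min[of "J - {i}"] card_Diff1_less[OF finite i] by auto
      then obtain s where s: "s \<in> S" "\<forall>j\<in>J - {i}. s $ j = 0" "s \<noteq> 0"
        by (auto simp: det_def)
      then have "s $ i \<noteq> 0" using J by (auto simp: det_def)
      then show ?thesis
        using s vec.subspace_scale[OF S s(1)] by (intro bexI[of _ "inverse (s $ i) *s s"]) auto
    qed
    then obtain e where e: "\<And>i. i \<in> J \<Longrightarrow> e i \<in> S"
      "\<And>i j. i \<in> J \<Longrightarrow> j \<in> J \<Longrightarrow> e i $ j = (if j = i then 1 else 0)" by metis
    have "(\<Sum>i\<in>J. x $ i *s e i) $ j = x $ j" if "j \<in> J" for j
      using that by (simp add: e(2) if_distrib[of "\<lambda>y. _ * y"] cong: if_cong)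
    moreover have "(\<Sum>i\<in>J. x $ i *s e i) \<in> S"
      using e(1) by (intro vec.subspace_sum[OF S] vec.subspace_scale[OF S])
    ultimately show ?thesis by blast
  qed
  ultimately show ?thesis using that by blast
qed

section \<open>Diameter and cardinality of an elementary linear subspace\<close>

theorem proposition1:
  fixes K :: "'a::{field,finite} set"
    and S :: "('a ^ 'n::finite) set"
    and q r n m :: nat
  assumes "primepow q"
    and "is_subfield K" and "card K = q"
    and "CARD('a) = q ^ m" and "CARD('n) = n"
    and "2 \<le> 2 * r" and "2 * r \<le> n" and "n \<le> m"
    and "S \<in> elementary_linear_subspaces K (2 * r)"
  shows "rank_diameter K S = 2 * r \<and> card S > rank_ball_volume K TYPE('n) r"
proof -
  note K = \<open>is_subfield K\<close>
  have q: "1 < q" using \<open>primepow q\<close> by (simp add: primepow_gt_Suc_0)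
  obtain B where S: "vec.subspace S" and "vec.dim S = 2 * r" and BK: "B \<subseteq> {x. \<forall>i. x $ i \<in> K}"
    and B: "vec.independent B" "vec.span B = S"
    using assms(9) unfolding elementary_linear_subspaces_def by blast
  then have cardB: "card B = 2 * r" using vec.dim_span_eq_card_independent[of B] by simp
  then have cardS: "card S = CARD('a) ^ (2 * r)"
    using card_vec_span_independent[OF B(1)] B(2) by simp

  have upper: "rk K x \<le> 2 * r" if "x \<in> S" for x
  proof -
    have "x \<in> range (\<lambda>u. \<Sum>v\<in>B. u v *s v)"
      using that B(2) vec.span_finite[OF finite[of B]] by simp
    then obtain u where u: "x = (\<Sum>v\<in>B. u v *s v)" by blast
    \<comment> \<open>The roles swap here: the entries of basis vectors, which lie in
      \<open>K\<close>, act as scalars, and the coefficients \<open>u v\<close> generate.\<close>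
    have "x $ i = (\<Sum>v\<in>B. v $ i * u v)" for i by (simp add: u mult.commute)
    also have "(\<Sum>v\<in>B. v $ i * u v) \<in> kspan K u B" for i using BK by (intro kspanI) auto
    finally show ?thesis using rk_le_kspan[OF K finite finite] cardB by metis
  qed

  obtain J where J: "card S \<le> CARD('a) ^ card J" "\<And>x. \<exists>s\<in>S. \<forall>j\<in>J. s $ j = x $ j"
    using subspace_onto_coords[OF S] by metis
  have "1 < CARD('a)" using card_mono[of UNIV "{0, 1 :: 'a}"] by simp
  then have rJ: "2 * r \<le> card J" using J(1) cardS by simp
  \<comment> \<open>This is where \<open>n \<le> m\<close> enters the diameter: the field is large
    enough over \<open>K\<close> for \<open>card J\<close> independent coordinates.\<close>
  have "card J \<le> m" using card_mono[of UNIV J] assms by simp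
  then have "q ^ card J \<le> q ^ m" using q by simp
  then obtain x :: "'a ^ 'n" where x: "coords_indep K x J"
    using ex_coords_indep[OF K] assms by metis
  obtain s where s: "s \<in> S" "\<forall>j\<in>J. s $ j = x $ j" using J(2) by blast
  have "coords_indep K s J" using x s(2) by (simp add: coords_indep_def)
  \<comment> \<open>So far \<open>J\<close> might have more than \<open>2 * r\<close> positions; the
    upper bound on the rank in \<open>S\<close> closes the chain.\<close>
  then have "rk K s = 2 * r" using coords_indep_imp_le_rk rJ upper[OF s(1)] by (meson le_antisym le_trans)
  then have dist: "rank_dist K s 0 = 2 * r" by (simp add: rank_dist_def)

  have "rank_diameter K S = 2 * r"
    unfolding rank_diameter_def
  proof (rule Max_eqI)
    have "{rank_dist K x y |x y. x \<in> S \<and> y \<in> S} \<subseteq> {..2 * r}"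
      using upper vec.subspace_diff[OF S] by (auto simp: rank_dist_def)
    then show "finite {rank_dist K x y |x y. x \<in> S \<and> y \<in> S}" by (rule finite_subset) simp
    show "2 * r \<in> {rank_dist K x y |x y. x \<in> S \<and> y \<in> S}"
      using dist s(1) vec.subspace_0[OF S] by force
  qed (use upper vec.subspace_diff[OF S] in \<open>auto simp: rank_dist_def\<close>)
  moreover have "rank_ball_volume K TYPE('n) r < card S"
  proof -
    have "rank_ball_volume K TYPE('n) r < CARD('a) ^ r * card K ^ (CARD('n) * r)"
      using assms by (intro card_rank_ball_less[OF K]) auto
    \<comment> \<open>Replacing \<open>n\<close> by \<open>m\<close> turns the second factor into
      another \<open>CARD('a) ^ r\<close>.\<close>
    also have "\<dots> \<le> CARD('a) ^ r * card K ^ (m * r)"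
      using assms q by simp
    also have "\<dots> = card S"
      using assms by (simp add: cardS power_mult mult_2 power_add)
    finally show ?thesis .
  qed
  ultimately show ?thesis by simp
qed

end
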